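(* Let $M$ be an $n\times n$ $q$-Manin matrix over $\mathfrak R$. If $M$ is invertible from the right and its $q$-determinant $\det_q M$ is invertible from the left, then the inverse matrix $M^{-1}$ is a $q^{-1}$-Manin matrix.
   Context: Let $q$ be a nonzero complex number and $\mathfrak R$ an associative unital, not necessarily commutative, algebra over $\mathbb C$. For $p\in\mathbb C\setminus\{0\}$, an $n\times m$ matrix $M=(M_{ij})$ over $\mathfrak R$ is called $p$-Manin if $M_{ij}M_{kj}=p^{-1}M_{kj}M_{ij}$ for all $j$ and all $i<k$, and $M_{ij}M_{kl}-M_{kl}M_{ij}=p^{-1}M_{kj}M_{il}-p\,M_{il}M_{kj}$ for all $i<k$, $j<l$. The $q$-determinant is $\det_q M=\sum_{\tau\in\mathfrak S_n}(-q)^{-\mathrm{inv}(\tau)}M_{\tau(1)1}M_{\tau(2)2}\cdots M_{\tau(n)n}$, where $\mathrm{inv}(\tau)$ is the number of inversions of $\tau$. (Under the hypotheses $M$ is two-sided invertible, since left invertibility of $\det_q M$ implies left invertibility of $M$; $M^{-1}$ denotes its unique two-sided inverse over $\mathfrak R$.) *)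

theory Defs
  imports
    Complex_Main
    "HOL-Combinatorics.Permutations"
    "Jordan_Normal_Form.Matrix"
begin

text \<open>
  Associative unital algebras over the complex numbers. The sort \<open>{ring, monoid_mult}\<close> is that of
  unital rings; unlike \<open>ring_1\<close> it does not demand \<open>0 \<noteq> 1\<close>, so the zero algebra is included.
\<close>

locale complex_algebra = vector_space scale
  for scale :: "complex \<Rightarrow> 'a::{ring, monoid_mult} \<Rightarrow> 'a" +
  assumes scale_mult_left: "scale c x * y = scale c (x * y)"
    and scale_mult_right: "x * scale c y = scale c (x * y)"

text \<open>Rows and columns are numbered from \<open>0\<close>.\<close>

definition manin_mat :: "(complex \<Rightarrow> 'a::{ring, monoid_mult} \<Rightarrow> 'a) \<Rightarrow> complex \<Rightarrow> 'a mat \<Rightarrow> bool"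
  where "manin_mat scale p M \<longleftrightarrow>
    (\<forall>i k j. i < k \<and> k < dim_row M \<and> j < dim_col M \<longrightarrow>
      M $$ (i,j) * M $$ (k,j) = scale (inverse p) (M $$ (k,j) * M $$ (i,j))) \<and>
    (\<forall>i k j l. i < k \<and> k < dim_row M \<and> j < l \<and> l < dim_col M \<longrightarrow>
      M $$ (i,j) * M $$ (k,l) - M $$ (k,l) * M $$ (i,j) =
      scale (inverse p) (M $$ (k,j) * M $$ (i,l)) - scale p (M $$ (i,l) * M $$ (k,j)))"

definition inversion_number :: "nat \<Rightarrow> (nat \<Rightarrow> nat) \<Rightarrow> nat"
  where "inversion_number n \<tau> = card {(i,j). i < j \<and> j < n \<and> \<tau> j < \<tau> i}"

text \<open>
  The entries do not commute: the factors are multiplied from left to right in the order of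
  their columns.
\<close>

definition q_det :: "(complex \<Rightarrow> 'a::{ring, monoid_mult} \<Rightarrow> 'a) \<Rightarrow> complex \<Rightarrow> 'a mat \<Rightarrow> 'a"
  where "q_det scale q M =
    (\<Sum>\<tau> | \<tau> permutes {..<dim_col M}.
      scale ((- q) powi (- int (inversion_number (dim_col M) \<tau>)))
        (prod_list (map (\<lambda>j. M $$ (\<tau> j, j)) [0..<dim_col M])))"

text \<open>The library's \<open>inverts_mat\<close> is not used since it excludes the zero ring.\<close>

definition is_mat_inverse :: "nat \<Rightarrow> 'a::{ring, monoid_mult} mat \<Rightarrow> 'a mat \<Rightarrow> bool"
  where "is_mat_inverse n M N \<longleftrightarrow>
    N \<in> carrier_mat n n \<and> M * N = 1\<^sub>m n \<and> N * M = 1\<^sub>m n"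

definition mat_inverse :: "nat \<Rightarrow> 'a::{ring, monoid_mult} mat \<Rightarrow> 'a mat"
  where "mat_inverse n M = (THE N. is_mat_inverse n M N)"

end

theory Submission
  imports Defs "HOL-Combinatorics.Multiset_Permutations"
begin

text \<open>
  Put \<open>t = - inverse q\<close> and let \<open>\<psi>\<^sub>i\<close> be the generators of the quantum exterior algebra:
  \<open>\<psi>\<^sub>i \<psi>\<^sub>i = 0\<close> and \<open>\<psi>\<^sub>k \<psi>\<^sub>i = t \<psi>\<^sub>i \<psi>\<^sub>k\<close> for \<open>i < k\<close>, with coefficients from the algebra
  commuting with every \<open>\<psi>\<^sub>i\<close>. Comparing coefficients shows that \<open>M\<close> is \<open>q\<close>-Manin exactly when the
  columns \<open>\<phi>\<^sub>j = \<Sum>\<^sub>i \<psi>\<^sub>i M\<^sub>i\<^sub>j\<close> satisfy the same relations, and the product of all columns is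
  \<open>\<phi>\<^sub>0 \<dots> \<phi>\<^sub>n\<^sub>-\<^sub>1 = \<psi>\<^sub>0 \<dots> \<psi>\<^sub>n\<^sub>-\<^sub>1 det\<^sub>q M\<close>.

  If \<open>det\<^sub>q M\<close> has a left inverse, the products of \<open>r\<close> columns in increasing order are linearly
  independent over the algebra acting from the right (\<open>wedges_independent\<close>): multiply a relation
  from the left by the columns outside one chosen \<open>r\<close>-subset. Every other product then contains a
  repeated column and dies, and the chosen one becomes a nonzero complex multiple of \<open>det\<^sub>q M\<close>.

  For \<open>r = 1\<close> this makes \<open>M\<close> left cancellable, so a right inverse \<open>N\<close> is two-sided because
  \<open>M (N M - 1) = 0\<close>. For \<open>r = 2\<close>, substituting \<open>\<psi>\<^sub>a = \<Sum>\<^sub>j \<phi>\<^sub>j N\<^sub>j\<^sub>a\<close> gives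
  \<open>\<psi>\<^sub>a \<psi>\<^sub>b = \<Sum>\<^sub>j\<^sub><\<^sub>l \<phi>\<^sub>j \<phi>\<^sub>l E\<^sub>a\<^sub>b(j,l)\<close> with \<open>E\<^sub>a\<^sub>b(j,l) = N\<^sub>l\<^sub>b N\<^sub>j\<^sub>a + t N\<^sub>j\<^sub>b N\<^sub>l\<^sub>a\<close>. The relations
  among the \<open>\<psi>\<^sub>a\<close> and the independence of the \<open>\<phi>\<^sub>j \<phi>\<^sub>l\<close> yield \<open>E\<^sub>a\<^sub>a = 0\<close> and \<open>E\<^sub>b\<^sub>a = t E\<^sub>a\<^sub>b\<close> for
  \<open>a < b\<close> (\<open>inverse_relations\<close>), which are the Manin relations of \<open>N\<close>
  for the parameter \<open>inverse q\<close>.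
\<close>

section \<open>Inversions of words\<close>

definition inversions :: "nat list \<Rightarrow> nat"
  where "inversions w = card {(i,j). i < j \<and> j < length w \<and> w ! j < w ! i}"

lemma inversions_Nil [simp]: "inversions [] = 0"
  by (simp add: inversions_def)

text \<open>
  The exponent of \<open>t\<close> picked up when \<open>\<psi>\<^sub>x\<close> is multiplied onto a sorted monomial is the first
  summand; thus the inversion numbers in the \<open>q\<close>-determinant arise one column at a time.
\<close>

lemma inversions_Cons:
  assumes "distinct w"
  shows "inversions (x # w) = card {s \<in> set w. s < x} + inversions w"
proof -
  let ?P = "{(i,j). i < j \<and> j < length w \<and> w ! j < w ! i}"
  let ?J = "{j. j < length w \<and> w ! j < x}"
  have split: "{(i,j). i < j \<and> j < length (x # w) \<and> (x # w) ! j < (x # w) ! i}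
      = (\<lambda>j. (0, Suc j)) ` ?J \<union> map_prod Suc Suc ` ?P"
    (is "?L = ?R")
    \<comment> \<open>the inversions that involve the new first letter, and the old ones shifted by one\<close>
  proof (rule Set.set_eqI)
    fix p show "p \<in> ?L \<longleftrightarrow> p \<in> ?R"
    proof (cases p)
      case (Pair a b)
      then show ?thesis
        by (cases a; cases b) auto
    qed
  qed
  have fin: "finite ?P"
    by (rule finite_subset[of _ "{..<length w} \<times> {..<length w}"]) auto
  have "(\<lambda>j. w ! j) ` ?J = {s \<in> set w. s < x}"
    by (auto simp: in_set_conv_nth)
  moreover have "inj_on (\<lambda>j. w ! j) ?J"
    using assms by (auto simp: inj_on_def nth_eq_iff_index_eq)
  ultimately have "card {s \<in> set w. s < x} = card ?J"
    by (metis card_image)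
  moreover have "card ((\<lambda>j. (0::nat, Suc j)) ` ?J) = card ?J"
    by (rule card_image) (auto simp: inj_on_def)
  moreover have "card (map_prod Suc Suc ` ?P) = card ?P"
    by (rule card_image) (auto simp: inj_on_def)
  moreover have "card ?L = card ((\<lambda>j. (0::nat, Suc j)) ` ?J) + card (map_prod Suc Suc ` ?P)"
    unfolding split using fin by (intro card_Un_disjoint) auto
  ultimately show ?thesis
    by (simp add: inversions_def)
qed

lemma inversion_number_eq_inversions:
  "inversion_number n \<tau> = inversions (map \<tau> [0..<n])"
proof -
  have "{(i,j). i < j \<and> j < n \<and> \<tau> j < \<tau> i}
      = {(i,j). i < j \<and> j < length (map \<tau> [0..<n]) \<and> map \<tau> [0..<n] ! j < map \<tau> [0..<n] ! i}"
    by auto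
  then show ?thesis
    by (simp add: inversion_number_def inversions_def)
qed

lemma bij_betw_permutes_permutations_of_set:
  "bij_betw (\<lambda>\<tau>. map \<tau> [0..<n]) {\<tau>. \<tau> permutes {..<n}} (permutations_of_set {..<n})"
proof (rule bij_betwI')
  fix \<sigma> \<tau> assume "\<sigma> \<in> {\<tau>. \<tau> permutes {..<n}}" "\<tau> \<in> {\<tau>. \<tau> permutes {..<n}}"
  then show "map \<sigma> [0..<n] = map \<tau> [0..<n] \<longleftrightarrow> \<sigma> = \<tau>"
    by (auto simp: permutes_def fun_eq_iff)
next
  fix \<tau> assume "\<tau> \<in> {\<tau>. \<tau> permutes {..<n}}"
  then have "\<tau> permutes {..<n}" by simp
  then show "map \<tau> [0..<n] \<in> permutations_of_set {..<n}"
    by (intro permutations_of_setI)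
      (auto simp: distinct_map permutes_inj_on atLeast0LessThan permutes_image)
next
  fix w assume "w \<in> permutations_of_set {..<n}"
  then have w: "set w = {..<n}" "distinct w" by (auto dest: permutations_of_setD)
  then have len: "length w = n" using distinct_card[of w] by simp
  let ?\<tau> = "\<lambda>i. if i < n then w ! i else i"
  have "bij_betw (\<lambda>i. w ! i) {..<n} {..<n}"
    using w len by (intro bij_betw_nth) auto
  then have "bij_betw ?\<tau> {..<n} {..<n}"
    by (subst bij_betw_cong[where g = "\<lambda>i. w ! i"]) auto
  then have "?\<tau> permutes {..<n}"
    by (rule bij_imp_permutes) auto
  moreover have "w = map ?\<tau> [0..<n]"
    using len by (intro nth_equalityI) auto
  ultimately show "\<exists>\<tau>\<in>{\<tau>. \<tau> permutes {..<n}}. w = map \<tau> [0..<n]" by blast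
qed

section \<open>Sums over pairs\<close>

definition ordered_pairs :: "nat set \<Rightarrow> (nat \<times> nat) set"
  where "ordered_pairs S = {(i,k). i \<in> S \<and> k \<in> S \<and> i < k}"

lemma finite_ordered_pairs: "finite S \<Longrightarrow> finite (ordered_pairs S)"
  by (rule finite_subset[of _ "S \<times> S"]) (auto simp: ordered_pairs_def)

lemma sum_off_diagonal:
  fixes g :: "nat \<Rightarrow> nat \<Rightarrow> 'b::comm_monoid_add"
  assumes "finite S"
  shows "(\<Sum>i\<in>S. \<Sum>k\<in>S - {i}. g i k) = (\<Sum>(i,k)\<in>ordered_pairs S. g i k + g k i)"
proof -
  let ?P = "ordered_pairs S"
  have split: "(SIGMA i:S. S - {i}) = ?P \<union> prod.swap ` ?P"
    by (auto simp: ordered_pairs_def image_iff)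
  have "(\<Sum>i\<in>S. \<Sum>k\<in>S - {i}. g i k) = (\<Sum>(i,k)\<in>(SIGMA i:S. S - {i}). g i k)"
    using assms by (intro sum.Sigma) auto
  also have "\<dots> = (\<Sum>(i,k)\<in>?P. g i k) + (\<Sum>(i,k)\<in>prod.swap ` ?P. g i k)"
    unfolding split using assms
    by (intro sum.union_disjoint finite_imageI finite_ordered_pairs)
      (auto simp: ordered_pairs_def)
  also have "(\<Sum>(i,k)\<in>prod.swap ` ?P. g i k) = (\<Sum>(i,k)\<in>?P. g k i)"
    by (subst sum.reindex) (auto simp: inj_on_def intro!: sum.cong)
  finally show ?thesis
    by (simp add: sum.distrib[symmetric] case_prod_unfold)
qed

lemma sum_all_pairs:
  fixes g :: "nat \<Rightarrow> nat \<Rightarrow> 'b::comm_monoid_add"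
  assumes "finite S" and "\<And>i. g i i = 0"
  shows "(\<Sum>i\<in>S. \<Sum>k\<in>S. g i k) = (\<Sum>(i,k)\<in>ordered_pairs S. g i k + g k i)"
proof -
  have "(\<Sum>k\<in>S. g i k) = (\<Sum>k\<in>S - {i}. g i k)" if "i \<in> S" for i
    using that assms by (subst sum.remove[of S i]) auto
  then show ?thesis
    using sum_off_diagonal[OF assms(1), of g] by simp
qed

section \<open>Columns acting on the quantum exterior algebra\<close>

locale column_family = complex_algebra scale
  for scale :: "complex \<Rightarrow> 'a::{ring, monoid_mult} \<Rightarrow> 'a" +
  fixes t :: complex and m :: "nat \<Rightarrow> nat \<Rightarrow> 'a"
begin

text \<open>
  A function \<open>f\<close> on sets of indices stands for the element \<open>\<Sum>\<^sub>S \<psi>\<^sub>S f(S)\<close> of the quantum exterior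
  algebra, where \<open>\<psi>\<^sub>S\<close> is the increasing product of the \<open>\<psi>\<^sub>i\<close> with \<open>i \<in> S\<close>. On these functions
  \<open>wedge j\<close> is left multiplication by the column \<open>\<phi>\<^sub>j\<close>: moving \<open>\<psi>\<^sub>i\<close> to its place in \<open>\<psi>\<^sub>S\<close> costs one
  factor \<open>t\<close> for each smaller index. Working with these operators avoids constructing the algebra
  and proving its product associative.
\<close>

definition wedge :: "nat \<Rightarrow> (nat set \<Rightarrow> 'a) \<Rightarrow> nat set \<Rightarrow> 'a"
  where "wedge j f S = (\<Sum>i\<in>S. scale (t ^ card {s\<in>S. s < i}) (m i j * f (S - {i})))"

text \<open>The unit of the quantum exterior algebra, the empty monomial.\<close>

definition vacuum :: "nat set \<Rightarrow> 'a"
  where "vacuum S = (if S = {} then 1 else 0)"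

text \<open>
  The coefficient of \<open>\<psi>\<^sub>i \<psi>\<^sub>k\<close> in \<open>\<phi>\<^sub>j \<phi>\<^sub>l\<close>, for \<open>i < k\<close>. It is a \<open>q\<close>-minor of size two.
\<close>

definition minor2 :: "nat \<Rightarrow> nat \<Rightarrow> nat \<Rightarrow> nat \<Rightarrow> 'a"
  where "minor2 j l i k = m i j * m k l + scale t (m k j * m i l)"

abbreviation wedges :: "nat list \<Rightarrow> (nat set \<Rightarrow> 'a) \<Rightarrow> nat set \<Rightarrow> 'a"
  where "wedges \<equiv> foldr wedge"

lemma wedge_zero: "wedge j (\<lambda>S. 0) = (\<lambda>S. 0)"
  by (simp add: wedge_def fun_eq_iff)

lemma wedge_scale: "wedge j (\<lambda>S. scale c (f S)) = (\<lambda>S. scale c (wedge j f S))"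
  by (simp add: wedge_def fun_eq_iff scale_mult_right scale_sum_right mult.commute)

text \<open>
  Columns act by multiplication from the left, so they commute with right multiplication by
  coefficients. This is what allows a right-linear relation to be multiplied by further columns.
\<close>

lemma wedge_sum_mult:
  "wedge j (\<lambda>S. \<Sum>x\<in>I. f x S * y x) = (\<lambda>S. \<Sum>x\<in>I. wedge j (f x) S * y x)"
proof
  fix S
  have "wedge j (\<lambda>S. \<Sum>x\<in>I. f x S * y x) S
      = (\<Sum>i\<in>S. \<Sum>x\<in>I. scale (t ^ card {s\<in>S. s < i}) (m i j * f x (S - {i})) * y x)"
    by (simp add: wedge_def sum_distrib_left scale_sum_right scale_mult_left mult.assoc)
  also have "\<dots> = (\<Sum>x\<in>I. wedge j (f x) S * y x)"
    by (subst sum.swap) (simp add: wedge_def sum_distrib_right)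
  finally show "wedge j (\<lambda>S. \<Sum>x\<in>I. f x S * y x) S = (\<Sum>x\<in>I. wedge j (f x) S * y x)" .
qed

lemma wedges_zero: "wedges js (\<lambda>S. 0) = (\<lambda>S. 0)"
  by (induction js) (simp_all add: wedge_zero)

lemma wedges_scale: "wedges js (\<lambda>S. scale c (f S)) = (\<lambda>S. scale c (wedges js f S))"
  by (induction js) (simp_all add: wedge_scale)

lemma wedges_sum_mult:
  "wedges js (\<lambda>S. \<Sum>x\<in>I. f x S * y x) = (\<lambda>S. \<Sum>x\<in>I. wedges js (f x) S * y x)"
  by (induction js) (simp_all add: wedge_sum_mult)

text \<open>
  The row indices of two successive columns form an unordered pair; the two orders of the pair
  differ by one factor \<open>t\<close>, which is exactly the factor in the minor. The truncated subtraction is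
  harmless since \<open>i\<close> itself lies below \<open>k\<close>.
\<close>

lemma wedge_wedge:
  assumes "finite S"
  shows "wedge j (wedge l f) S = (\<Sum>(i,k)\<in>ordered_pairs S.
    scale (t ^ (card {s\<in>S. s < i} + (card {s\<in>S. s < k} - 1))) (minor2 j l i k * f (S - {i,k})))"
proof -
  let ?b = "\<lambda>S i. card {s\<in>S. s < i}"
  define g where "g i k = scale (t ^ (?b S i + ?b (S - {i}) k)) (m i j * m k l * f (S - {i,k}))"
    for i k
  have "wedge j (wedge l f) S = (\<Sum>i\<in>S. \<Sum>k\<in>S - {i}. g i k)"
    by (simp add: wedge_def g_def sum_distrib_left scale_sum_right scale_mult_right power_add
        mult.assoc Diff_insert[symmetric] insert_commute)
  also have "\<dots> = (\<Sum>(i,k)\<in>ordered_pairs S. g i k + g k i)"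
    by (rule sum_off_diagonal[OF assms])
  also have "\<dots> = (\<Sum>(i,k)\<in>ordered_pairs S.
      scale (t ^ (?b S i + (?b S k - 1))) (minor2 j l i k * f (S - {i,k})))"
  proof (intro sum.cong refl, clarify)
    fix i k assume "(i,k) \<in> ordered_pairs S"
    then have ik: "i \<in> S" "k \<in> S" "i < k" by (auto simp: ordered_pairs_def)
    have "{s \<in> S - {i}. s < k} = {s\<in>S. s < k} - {i}" by auto
    then have 1: "?b (S - {i}) k = ?b S k - 1"
      using ik assms by simp
    have "{s \<in> S - {k}. s < i} = {s\<in>S. s < i}" using ik by auto
    then have 2: "?b (S - {k}) i = ?b S i" by simp
    have "i \<in> {s\<in>S. s < k}" using ik by simp
    then have "0 < ?b S k" using assms by (auto simp: card_gt_0_iff)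
    then have 3: "?b S k + ?b S i = Suc (?b S i + (?b S k - 1))" by simp
    have "g k i = scale (t ^ (?b S i + (?b S k - 1))) (scale t (m k j * m i l) * f (S - {i,k}))"
      unfolding g_def 2 3 by (simp add: scale_mult_left insert_commute mult.commute)
    moreover have "g i k = scale (t ^ (?b S i + (?b S k - 1))) (m i j * m k l * f (S - {i,k}))"
      unfolding g_def 1 ..
    ultimately show "g i k + g k i
      = scale (t ^ (?b S i + (?b S k - 1))) (minor2 j l i k * f (S - {i,k}))"
      by (simp only: minor2_def distrib_right scale_right_distrib)
  qed
  finally show ?thesis .
qed

lemma wedge_infinite: "infinite S \<Longrightarrow> wedge j f S = 0"
  by (simp add: wedge_def)

text \<open>
  The quantum minor with rows \<open>S\<close> and columns \<open>js\<close>, by repeated expansion along the first column.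
\<close>

lemma wedges_vacuum_eq_sum:
  assumes "finite S" "length js = card S"
  shows "wedges js vacuum S
    = (\<Sum>w\<in>permutations_of_set S. scale (t ^ inversions w) (prod_list (map2 m w js)))"
  using assms
proof (induction js arbitrary: S)
  case Nil
  then show ?case by (simp add: vacuum_def)
next
  case (Cons j js)
  let ?term = "\<lambda>w js. scale (t ^ inversions w) (prod_list (map2 m w js))"
  have "S \<noteq> {}" using Cons.prems by auto
  have "wedges (j # js) vacuum S
      = (\<Sum>i\<in>S. \<Sum>w\<in>permutations_of_set (S - {i}). ?term (i # w) (j # js))"
  proof -
    have "scale (t ^ card {s\<in>S. s < i}) (m i j * wedges js vacuum (S - {i}))
        = (\<Sum>w\<in>permutations_of_set (S - {i}). ?term (i # w) (j # js))" if "i \<in> S" for i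
    proof -
      have "wedges js vacuum (S - {i}) = (\<Sum>w\<in>permutations_of_set (S - {i}). ?term w js)"
        using Cons.prems that by (intro Cons.IH) auto
      moreover have "inversions (i # w) = card {s\<in>S. s < i} + inversions w"
        if "w \<in> permutations_of_set (S - {i})" for w
      proof -
        have "{s \<in> S - {i}. s < i} = {s\<in>S. s < i}" by auto
        then show ?thesis
          using permutations_of_setD[OF that] by (simp add: inversions_Cons)
      qed
      ultimately show ?thesis
        by (simp add: sum_distrib_left scale_sum_right scale_mult_right power_add)
    qed
    then show ?thesis by (simp add: wedge_def)
  qed
  also have "\<dots> = (\<Sum>i\<in>S. \<Sum>w\<in>(#) i ` permutations_of_set (S - {i}). ?term w (j # js))"
    by (simp add: sum.reindex inj_on_def)
  also have "\<dots> = (\<Sum>w\<in>permutations_of_set S. ?term w (j # js))"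
    unfolding permutations_of_set_nonempty[OF \<open>S \<noteq> {}\<close>] using Cons.prems
    by (intro sum.UNION_disjoint[symmetric]) auto
  finally show ?case .
qed

end

section \<open>Manin families\<close>

text \<open>
  The Manin relations, expressed by minors: equal columns have vanishing minors, and exchanging two
  columns multiplies the minors by \<open>t\<close>. They are required for all natural numbers as indices; a
  finite matrix is extended by zero.
\<close>

locale manin_family = column_family +
  assumes t_nonzero: "t \<noteq> 0"
    and minor2_same: "i < k \<Longrightarrow> minor2 j j i k = 0"
    and minor2_swap: "i < k \<Longrightarrow> j < l \<Longrightarrow> minor2 l j i k = scale t (minor2 j l i k)"
begin

lemma wedge_wedge_same: "wedge j (wedge j f) = (\<lambda>S. 0)"
proof
  fix S show "wedge j (wedge j f) S = 0"
  proof (cases "finite S")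
    case True
    then show ?thesis
      by (auto simp: wedge_wedge minor2_same ordered_pairs_def intro!: sum.neutral)
  qed (simp add: wedge_infinite)
qed

lemma wedge_wedge_swap:
  assumes "j < l"
  shows "wedge l (wedge j f) = (\<lambda>S. scale t (wedge j (wedge l f) S))"
proof
  fix S show "wedge l (wedge j f) S = scale t (wedge j (wedge l f) S)"
  proof (cases "finite S")
    case True
    then show ?thesis using assms
      by (auto simp: wedge_wedge minor2_swap ordered_pairs_def scale_sum_right scale_mult_left
          mult.commute intro!: sum.cong)
  qed (simp add: wedge_infinite)
qed

text \<open>
  A nonzero complex factor can always be cancelled, so it is enough to know that exchanging columns
  produces one; its value is never needed.
\<close>

lemma wedge_wedge_commute_up_to_unit:
  "\<exists>u. u \<noteq> 0 \<and> wedge j (wedge l f) = (\<lambda>S. scale u (wedge l (wedge j f) S))"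
proof (cases j l rule: linorder_cases)
  case less
  then show ?thesis
    by (intro exI[of _ "inverse t"]) (simp add: wedge_wedge_swap t_nonzero)
next
  case equal
  then show ?thesis by (intro exI[of _ 1]) simp
next
  case greater
  then show ?thesis using t_nonzero by (intro exI[of _ t]) (simp add: wedge_wedge_swap)
qed

lemma wedge_wedges_mem:
  assumes "j \<in> set js"
  shows "wedge j (wedges js f) = (\<lambda>S. 0)"
  using assms
proof (induction js)
  case (Cons l js)
  show ?case
  proof (cases "l = j")
    case True
    then show ?thesis by (simp add: wedge_wedge_same)
  next
    case False
    then have "wedge j (wedges js f) = (\<lambda>S. 0)" using Cons by simp
    moreover obtain u where
      "wedge j (wedge l (wedges js f)) = (\<lambda>S. scale u (wedge l (wedge j (wedges js f)) S))"
      using wedge_wedge_commute_up_to_unit by blast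
    ultimately show ?thesis by (simp add: wedge_zero)
  qed
qed simp

lemma wedges_not_distinct:
  "\<not> distinct js \<Longrightarrow> wedges js f = (\<lambda>S. 0)"
  by (induction js) (auto simp: wedge_wedges_mem wedge_zero)

lemma wedges_insort:
  "\<exists>u. u \<noteq> 0 \<and> wedges (insort j js) f = (\<lambda>S. scale u (wedge j (wedges js f) S))"
proof (induction js)
  case Nil
  show ?case by (intro exI[of _ 1]) simp
next
  case (Cons l js)
  show ?case
  proof (cases "j \<le> l")
    case True
    then show ?thesis by (intro exI[of _ 1]) simp
  next
    case False
    obtain u where u: "u \<noteq> 0" "wedges (insort j js) f = (\<lambda>S. scale u (wedge j (wedges js f) S))"
      using Cons.IH by blast
    obtain v where v: "v \<noteq> 0"
      "wedge l (wedge j (wedges js f)) = (\<lambda>S. scale v (wedge j (wedge l (wedges js f)) S))"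
      using wedge_wedge_commute_up_to_unit by blast
    show ?thesis
      using False u v by (intro exI[of _ "u * v"]) (simp add: wedge_scale)
  qed
qed

lemma wedges_sort:
  "\<exists>u. u \<noteq> 0 \<and> wedges (sort js) f = (\<lambda>S. scale u (wedges js f S))"
proof (induction js)
  case Nil
  show ?case by (intro exI[of _ 1]) simp
next
  case (Cons j js)
  obtain u where u: "u \<noteq> 0" "wedges (sort js) f = (\<lambda>S. scale u (wedges js f S))"
    using Cons.IH by blast
  obtain v where v: "v \<noteq> 0"
    "wedges (insort j (sort js)) f = (\<lambda>S. scale v (wedge j (wedges (sort js) f) S))"
    using wedges_insort by blast
  show ?case
    using u v by (intro exI[of _ "v * u"]) (simp add: wedge_scale)
qed

text \<open>
  The core of the argument. It replaces the Laplace expansion of \<open>det\<^sub>q M\<close>: the words \<open>w x\<close> name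
  different column subsets of one size \<open>r\<close>, so the complement of one of them meets all the others.
\<close>

lemma wedges_independent:
  assumes inv: "d * wedges [0..<n] vacuum {..<n} = 1"
    and fin: "finite I"
    and subset: "\<And>x. x \<in> I \<Longrightarrow> set (w x) \<subseteq> {..<n}"
    and dist: "\<And>x. x \<in> I \<Longrightarrow> distinct (w x)"
    and len: "\<And>x. x \<in> I \<Longrightarrow> length (w x) = r"
    and inj: "inj_on (\<lambda>x. set (w x)) I"
    and rel: "\<And>S. (\<Sum>x\<in>I. wedges (w x) vacuum S * y x) = 0"
    and x: "x \<in> I"
  shows "y x = 0"
proof -
  define c where "c = sorted_list_of_set ({..<n} - set (w x))"
  have c: "set c = {..<n} - set (w x)" "distinct c" by (simp_all add: c_def)
  let ?D = "wedges [0..<n] vacuum {..<n}"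
  have other: "wedges (c @ w z) vacuum = (\<lambda>S. 0)" if z: "z \<in> I" "z \<noteq> x" for z
  proof (rule wedges_not_distinct)
    have "set (w z) \<noteq> set (w x)" using inj z x by (auto simp: inj_on_def)
    moreover have "card (set (w z)) = card (set (w x))"
      using dist len z x by (simp add: distinct_card)
    ultimately have "\<not> set (w z) \<subseteq> set (w x)"
      by (metis List.finite_set card_subset_eq)
    then show "\<not> distinct (c @ w z)" using subset[OF z(1)] c by auto
  qed
  have "sort (c @ w x) = [0..<n]"
    using c subset[OF x] dist[OF x]
    by (intro sorted_distinct_set_unique) (auto simp: atLeast0LessThan)
  then obtain u where u: "u \<noteq> 0" "wedges [0..<n] vacuum = (\<lambda>S. scale u (wedges (c @ w x) vacuum S))"
    using wedges_sort[of "c @ w x" vacuum] by auto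
  have "0 = wedges c (\<lambda>S. \<Sum>z\<in>I. wedges (w z) vacuum S * y z) {..<n}"
    by (simp add: rel wedges_zero)
  also have "\<dots> = (\<Sum>z\<in>I. wedges (c @ w z) vacuum {..<n} * y z)"
    by (simp add: wedges_sum_mult)
  also have "\<dots> = wedges (c @ w x) vacuum {..<n} * y x"
    using fin x other by (subst sum.remove[of I x]) auto
  finally have "?D * y x = 0"
    using fun_cong[OF u(2), of "{..<n}"] by (simp add: scale_mult_left)
  then show ?thesis
    by (metis inv mult.assoc mult_1_left mult_zero_right)
qed

text \<open>
  Here and in the next lemma, independence for \<open>r = 1\<close> and \<open>r = 2\<close> is turned into a statement about
  entries and minors. Only the coefficients of the monomials of degree \<open>r\<close> have to be compared,
  since a product of \<open>r\<close> columns has no others.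
\<close>

lemma columns_independent:
  assumes inv: "d * wedges [0..<n] vacuum {..<n} = 1"
    and rel: "\<And>i. (\<Sum>j<n. m i j * y j) = 0"
    and "j < n"
  shows "y j = 0"
proof (rule wedges_independent[OF inv, where I = "{..<n}" and w = "\<lambda>j. [j]" and r = 1])
  fix S
  have "(\<Sum>j<n. wedges [j] vacuum S * y j) = (\<Sum>i\<in>S. \<Sum>j<n.
      scale (t ^ card {s\<in>S. s < i}) (m i j * vacuum (S - {i})) * y j)"
    by (simp add: wedge_def sum_distrib_right) (rule sum.swap)
  also have "\<dots> = (\<Sum>i\<in>S. scale (t ^ card {s\<in>S. s < i})
      (if S - {i} = {} then \<Sum>j<n. m i j * y j else 0))"
    by (intro sum.cong refl) (simp add: vacuum_def scale_mult_left scale_sum_right)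
  also have "\<dots> = 0" by (intro sum.neutral) (simp add: rel)
  finally show "(\<Sum>j<n. wedges [j] vacuum S * y j) = 0" .
qed (use assms(3) in \<open>auto simp: inj_on_def\<close>)

lemma minors_independent:
  assumes inv: "d * wedges [0..<n] vacuum {..<n} = 1"
    and rel: "\<And>i k. i < k \<Longrightarrow> (\<Sum>(j,l)\<in>ordered_pairs {..<n}. minor2 j l i k * y j l) = 0"
    and "j < l" "l < n"
  shows "y j l = 0"
proof -
  let ?P = "ordered_pairs {..<n}"
  have "(\<lambda>(j,l). y j l) (j,l) = 0"
  proof (rule wedges_independent[OF inv, where I = ?P and w = "\<lambda>(j,l). [j,l]" and r = 2])
    fix S
    show "(\<Sum>p\<in>?P. wedges (case p of (j,l) \<Rightarrow> [j,l]) vacuum S * (case p of (j,l) \<Rightarrow> y j l)) = 0"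
    proof (cases "finite S")
      case True
      let ?e = "\<lambda>(i,k). card {s\<in>S. s < i} + (card {s\<in>S. s < k} - 1)"
      have "(\<Sum>p\<in>?P. wedges (case p of (j,l) \<Rightarrow> [j,l]) vacuum S * (case p of (j,l) \<Rightarrow> y j l))
        = (\<Sum>p\<in>?P. \<Sum>q\<in>ordered_pairs S. scale (t ^ ?e q)
          (minor2 (fst p) (snd p) (fst q) (snd q) * vacuum (S - {fst q, snd q})) * y (fst p) (snd p))"
        by (simp add: case_prod_unfold wedge_wedge[OF True] sum_distrib_right)
      also have "\<dots> = (\<Sum>q\<in>ordered_pairs S. \<Sum>p\<in>?P. scale (t ^ ?e q)
          (minor2 (fst p) (snd p) (fst q) (snd q) * vacuum (S - {fst q, snd q})) * y (fst p) (snd p))"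
        by (rule sum.swap)
      also have "\<dots> = (\<Sum>q\<in>ordered_pairs S. scale (t ^ ?e q)
          (if S - {fst q, snd q} = {}
           then \<Sum>(j,l)\<in>?P. minor2 j l (fst q) (snd q) * y j l else 0))"
        by (intro sum.cong refl)
          (simp add: vacuum_def scale_mult_left scale_sum_right case_prod_unfold)
      also have "\<dots> = 0"
      proof (intro sum.neutral ballI)
        fix q assume "q \<in> ordered_pairs S"
        then have "fst q < snd q" by (auto simp: ordered_pairs_def)
        then show "scale (t ^ ?e q) (if S - {fst q, snd q} = {}
            then \<Sum>(j,l)\<in>?P. minor2 j l (fst q) (snd q) * y j l else 0) = 0"
          by (simp add: rel)
      qed
      finally show ?thesis .
    qed (simp add: case_prod_unfold wedge_infinite)
  next
    have "j = j' \<and> l = l'" if "j < l" "j' < l'" "{j,l} = {j',l'}" for j l j' l' :: nat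
      using that by (auto simp: doubleton_eq_iff)
    then show "inj_on (\<lambda>p. set (case p of (j,l) \<Rightarrow> [j,l])) ?P"
      by (auto simp: inj_on_def ordered_pairs_def simp del: insert_iff)
  next
    show "finite ?P" by (rule finite_ordered_pairs) simp
  qed (use assms(3,4) in \<open>auto simp: ordered_pairs_def\<close>)
  then show ?thesis by simp
qed

text \<open>
  The coefficient of \<open>\<psi>\<^sub>i \<psi>\<^sub>k\<close> in \<open>\<psi>\<^sub>a \<psi>\<^sub>b = \<Sum>\<^sub>j\<^sub>,\<^sub>l \<phi>\<^sub>j \<phi>\<^sub>l N\<^sub>l\<^sub>b N\<^sub>j\<^sub>a\<close>. The factors of \<open>N\<close> come in
  reversed order since \<open>\<psi>\<^sub>b\<close>, which commutes with coefficients, is expanded in front of \<open>N\<^sub>j\<^sub>a\<close>.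
\<close>

lemma sum_minor2_mult_inverse:
  assumes MN: "\<And>i a. (\<Sum>j<n. m i j * N j a) = (if i = a \<and> i < n then 1 else 0)"
    and "i < k"
  shows "(\<Sum>(j,l)\<in>ordered_pairs {..<n}. minor2 j l i k * (N l b * N j a + scale t (N j b * N l a)))
    = (if k = b \<and> i = a \<and> k < n then 1 else 0)
      + (if i = b \<and> k = a \<and> k < n then scale t 1 else 0)"
    (is "?lhs = ?rhs")
proof -
  have "?lhs = (\<Sum>(j,l)\<in>ordered_pairs {..<n}.
      minor2 j l i k * (N l b * N j a) + minor2 l j i k * (N j b * N l a))"
    using assms(2) by (intro sum.cong refl)
      (auto simp: ordered_pairs_def minor2_swap distrib_left scale_mult_left scale_mult_right)
  also have "\<dots> = (\<Sum>j<n. \<Sum>l<n. minor2 j l i k * (N l b * N j a))"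
    using assms(2) by (subst sum_all_pairs) (simp_all add: minor2_same)
  \<comment> \<open>the inner sums are entries of \<open>M N = 1\<close>; the deltas they leave behind let the outer sums
     collapse in the same way\<close>
  also have "\<dots> = (\<Sum>j<n. m i j * (\<Sum>l<n. m k l * N l b) * N j a)
      + scale t (\<Sum>j<n. m k j * (\<Sum>l<n. m i l * N l b) * N j a)"
    by (simp add: minor2_def distrib_right sum.distrib scale_mult_left scale_sum_right
        sum_distrib_left sum_distrib_right mult.assoc)
  also have "\<dots> = ?rhs"
  proof -
    have pull_if: "(\<Sum>j<n. x j * (if P then 1 else 0) * y j) = (if P then \<Sum>j<n. x j * y j else 0)"
      for x y :: "nat \<Rightarrow> 'a" and P
      by simp
    show ?thesis using assms(2) by (auto simp: MN pull_if)
  qed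
  finally show ?thesis .
qed

text \<open>
  Both combinations \<open>E\<^sub>a\<^sub>a\<close> and \<open>E\<^sub>b\<^sub>a - t E\<^sub>a\<^sub>b\<close> are coefficient vectors of the zero element, namely of
  \<open>\<psi>\<^sub>a \<psi>\<^sub>a\<close> and of \<open>\<psi>\<^sub>b \<psi>\<^sub>a - t \<psi>\<^sub>a \<psi>\<^sub>b\<close>, in terms of the independent products \<open>\<phi>\<^sub>j \<phi>\<^sub>l\<close>.
\<close>

lemma inverse_relations:
  assumes inv: "d * wedges [0..<n] vacuum {..<n} = 1"
    and MN: "\<And>i a. (\<Sum>j<n. m i j * N j a) = (if i = a \<and> i < n then 1 else 0)"
    and "j < l" "l < n"
  shows "N l a * N j a + scale t (N j a * N l a) = 0"
    and "a < b \<Longrightarrow> N l a * N j b + scale t (N j a * N l b)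
      = scale t (N l b * N j a + scale t (N j b * N l a))"
proof -
  let ?E = "\<lambda>a b j l. N l b * N j a + scale t (N j b * N l a)"
  show "?E a a j l = 0"
    by (rule minors_independent[OF inv _ assms(3,4)])
      (auto simp: sum_minor2_mult_inverse[OF MN])
  assume "a < b"
  have "?E b a j l - scale t (?E a b j l) = 0"
  proof (rule minors_independent[OF inv _ assms(3,4)])
    fix i k :: nat assume "i < k"
    have "(\<Sum>(j,l)\<in>ordered_pairs {..<n}. minor2 j l i k * (?E b a j l - scale t (?E a b j l)))
      = (\<Sum>(j,l)\<in>ordered_pairs {..<n}. minor2 j l i k * ?E b a j l)
        - scale t (\<Sum>(j,l)\<in>ordered_pairs {..<n}. minor2 j l i k * ?E a b j l)"
      by (simp add: case_prod_unfold right_diff_distrib scale_mult_right sum_subtractf scale_sum_right)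
    also have "\<dots> = 0"
      using \<open>i < k\<close> \<open>a < b\<close> by (auto simp: sum_minor2_mult_inverse[OF MN])
    finally show "(\<Sum>(j,l)\<in>ordered_pairs {..<n}.
      minor2 j l i k * (?E b a j l - scale t (?E a b j l))) = 0" .
  qed
  then show "?E b a j l = scale t (?E a b j l)" by simp
qed

end

section \<open>The inverse of a Manin matrix\<close>

lemma mat_mult_index_sum:
  fixes A B :: "'a::semiring_0 mat"
  assumes "A \<in> carrier_mat n n" "B \<in> carrier_mat n n" "i < n" "j < n"
  shows "(A * B) $$ (i,j) = (\<Sum>k<n. A $$ (i,k) * B $$ (k,j))"
  using assms by (simp add: scalar_prod_def atLeast0LessThan)

theorem theorem4p7:
  fixes scale :: "complex \<Rightarrow> 'a::{ring, monoid_mult} \<Rightarrow> 'a"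
    and q :: complex and n :: nat and M :: "'a mat"
  assumes "complex_algebra scale"
    and "q \<noteq> 0"
    and "M \<in> carrier_mat n n"
    and "manin_mat scale q M"
    and "\<exists>R \<in> carrier_mat n n. M * R = 1\<^sub>m n"
    and "\<exists>d. d * q_det scale q M = 1"
  shows "(\<exists>!N. is_mat_inverse n M N) \<and> manin_mat scale (inverse q) (mat_inverse n M)"
proof -
  interpret complex_algebra scale by fact
  define t where "t = - inverse q"
  define m where "m i j = (if i < n \<and> j < n then M $$ (i,j) else 0)" for i j
  interpret column_family scale t m ..
  have dim [simp]: "dim_row M = n" "dim_col M = n" using assms(3) by auto
  have same: "M $$ (i,j) * M $$ (k,j) = scale (inverse q) (M $$ (k,j) * M $$ (i,j))"
    if "i < k" "k < n" "j < n" for i k j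
    using assms(4) that unfolding manin_mat_def by auto
  have cross: "M $$ (i,j) * M $$ (k,l) - M $$ (k,l) * M $$ (i,j) =
      scale (inverse q) (M $$ (k,j) * M $$ (i,l)) - scale q (M $$ (i,l) * M $$ (k,j))"
    if "i < k" "k < n" "j < l" "l < n" for i k j l
    using assms(4) that unfolding manin_mat_def by auto
  interpret manin_family scale t m
  proof
    show "t \<noteq> 0" using assms(2) by (simp add: t_def)
    fix i k j :: nat assume ik: "i < k"
    show "minor2 j j i k = 0"
      unfolding minor2_def using same[OF ik, of j] ik by (auto simp: m_def t_def)
    fix l assume jl: "j < l"
    show "minor2 l j i k = scale t (minor2 j l i k)"
    proof (cases "k < n \<and> l < n")
      case True
      have "scale (inverse q) (M $$ (i,j) * M $$ (k,l)) - scale (inverse q) (M $$ (k,l) * M $$ (i,j))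
        = scale (inverse q * inverse q) (M $$ (k,j) * M $$ (i,l)) - M $$ (i,l) * M $$ (k,j)"
        using arg_cong[OF cross[OF ik _ jl], of "scale (inverse q)"] True assms(2)
        by (simp add: scale_right_diff_distrib)
      then show ?thesis
        unfolding minor2_def using True ik jl
        by (simp add: m_def t_def scale_right_distrib algebra_simps)
    qed (auto simp: minor2_def m_def)
  qed

  have det: "q_det scale q M = wedges [0..<n] vacuum {..<n}"
  proof -
    have "(- q) powi (- int k) = t ^ k" for k
      by (simp add: t_def power_int_minus power_inverse[symmetric])
    moreover have "prod_list (map (\<lambda>j. M $$ (\<tau> j, j)) [0..<n])
        = prod_list (map2 m (map \<tau> [0..<n]) [0..<n])"
      if "\<tau> permutes {..<n}" for \<tau>
    proof -
      have "\<tau> j < n" if "j < n" for j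
        using permutes_in_image[OF \<open>\<tau> permutes {..<n}\<close>, of j] that by simp
      then show ?thesis
        by (intro arg_cong[of _ _ prod_list] nth_equalityI) (auto simp: m_def)
    qed
    ultimately have "q_det scale q M = (\<Sum>\<tau> | \<tau> permutes {..<n}.
        scale (t ^ inversions (map \<tau> [0..<n])) (prod_list (map2 m (map \<tau> [0..<n]) [0..<n])))"
      by (simp add: q_det_def inversion_number_eq_inversions)
    also have "\<dots> = (\<Sum>w\<in>permutations_of_set {..<n}.
        scale (t ^ inversions w) (prod_list (map2 m w [0..<n])))"
      by (rule sum.reindex_bij_betw[OF bij_betw_permutes_permutations_of_set])
    also have "\<dots> = wedges [0..<n] vacuum {..<n}"
      by (simp add: wedges_vacuum_eq_sum)
    finally show ?thesis .
  qed
  with assms(6) obtain d where d: "d * wedges [0..<n] vacuum {..<n} = 1" by auto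

  obtain R where R: "R \<in> carrier_mat n n" "M * R = 1\<^sub>m n" using assms(5) by blast
  define N where "N j a = (if a < n then R $$ (j,a) else 0)" for j a
  have MN: "(\<Sum>j<n. m i j * N j a) = (if i = a \<and> i < n then 1 else 0)" for i a
  proof (cases "i < n \<and> a < n")
    case True
    then have "(\<Sum>j<n. m i j * N j a) = (M * R) $$ (i,a)"
      using mat_mult_index_sum[OF assms(3) R(1)] by (simp add: m_def N_def)
    then show ?thesis using True by (simp add: R(2))
  qed (auto simp: m_def N_def intro!: sum.neutral)

  have RM: "R * M = 1\<^sub>m n"
  proof (rule eq_matI)
    fix j b assume "j < dim_row (1\<^sub>m n :: 'a mat)" "b < dim_col (1\<^sub>m n :: 'a mat)"
    then have jb: "j < n" "b < n" by simp_all
    \<comment> \<open>column \<open>b\<close> of \<open>R M - 1\<close>, which \<open>M\<close> annihilates\<close>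
    define y where "y j = (\<Sum>a<n. N j a * m a b) - (if j = b then 1 else 0)" for j
    have "y j = 0"
    proof (rule columns_independent[OF d _ jb(1)])
      fix i
      have delta: "(\<Sum>j<n. m i j * (if j = b then 1 else 0)) = m i b"
        using jb(2) by (simp add: if_distrib cong: if_cong)
      have "(\<Sum>j<n. m i j * y j) = (\<Sum>j<n. \<Sum>a<n. m i j * N j a * m a b) - m i b"
        unfolding y_def right_diff_distrib sum_subtractf delta
        by (simp add: sum_distrib_left mult.assoc)
      also have "(\<Sum>j<n. \<Sum>a<n. m i j * N j a * m a b) = (\<Sum>a<n. (\<Sum>j<n. m i j * N j a) * m a b)"
        by (subst sum.swap) (simp add: sum_distrib_right)
      also have "\<dots> = m i b"
      proof (cases "i < n")
        case True
        have "(\<Sum>a<n. (\<Sum>j<n. m i j * N j a) * m a b) = (\<Sum>a<n. if a = i then m i b else 0)"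
          by (intro sum.cong refl) (simp add: MN True)
        then show ?thesis using True by simp
      qed (auto simp: MN m_def intro!: sum.neutral)
      finally show "(\<Sum>j<n. m i j * y j) = 0" by simp
    qed
    then show "(R * M) $$ (j,b) = 1\<^sub>m n $$ (j,b)"
      using jb mat_mult_index_sum[OF R(1) assms(3)] by (simp add: y_def N_def m_def)
  qed (use R(1) assms(3) in auto)

  have inverse: "is_mat_inverse n M R"
    using R RM by (simp add: is_mat_inverse_def)
  have unique: "N = R" if "is_mat_inverse n M N" for N
  proof -
    from that have N: "N \<in> carrier_mat n n" "N * M = 1\<^sub>m n" by (auto simp: is_mat_inverse_def)
    \<comment> \<open>the unit laws entry by entry, so that they hold in the zero algebra as well\<close>
    have one: "1\<^sub>m n * A = A" "A * 1\<^sub>m n = A" if "A \<in> carrier_mat n n" for A :: "'a mat"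
    proof -
      have delta: "(\<Sum>k<n. (if i = k then 1 else 0) * x k) = x i"
        "(\<Sum>k<n. x k * (if k = i then 1 else 0)) = x i" if "i < n" for i and x :: "nat \<Rightarrow> 'a"
        using that by (simp_all add: if_distrib if_distribR cong: if_cong)
      note entry = mat_mult_index_sum[OF one_carrier_mat that] mat_mult_index_sum[OF that one_carrier_mat]
      show "1\<^sub>m n * A = A" "A * 1\<^sub>m n = A"
        using that by (auto intro!: eq_matI simp: entry delta simp del: index_mult_mat(1))
    qed
    have "N = N * (M * R)" using N R one by simp
    also have "\<dots> = (N * M) * R" by (rule assoc_mult_mat[OF N(1) assms(3) R(1), symmetric])
    finally show ?thesis using N R one by simp
  qed
  have "mat_inverse n M = R"
    unfolding mat_inverse_def using inverse unique by blast
  moreover have "manin_mat scale (inverse q) R"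
  proof -
    have "R $$ (j,a) * R $$ (l,a) = scale q (R $$ (l,a) * R $$ (j,a))"
      if jl: "j < l" "l < n" and a: "a < n" for j l a
    proof -
      have "R $$ (l,a) * R $$ (j,a) = scale (inverse q) (R $$ (j,a) * R $$ (l,a))"
        using inverse_relations(1)[OF d MN jl, of a] a by (simp add: t_def N_def)
      then show ?thesis using assms(2) by simp
    qed
    moreover have "R $$ (j,a) * R $$ (l,b) - R $$ (l,b) * R $$ (j,a) =
        scale q (R $$ (l,a) * R $$ (j,b)) - scale (inverse q) (R $$ (j,b) * R $$ (l,a))"
      if jl: "j < l" "l < n" and ab: "a < b" "b < n" for j l a b
    proof -
      have "R $$ (l,a) * R $$ (j,b) - scale (inverse q) (R $$ (j,a) * R $$ (l,b))
        = - scale (inverse q) (R $$ (l,b) * R $$ (j,a))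
          + scale (inverse q * inverse q) (R $$ (j,b) * R $$ (l,a))"
        using inverse_relations(2)[OF d MN jl ab(1)] ab
        by (simp add: t_def N_def scale_right_diff_distrib)
      from arg_cong[OF this, of "scale q"] show ?thesis
        using assms(2) by (simp add: scale_right_diff_distrib scale_right_distrib algebra_simps)
    qed
    ultimately show ?thesis
      using R(1) unfolding manin_mat_def carrier_matD[OF R(1)] inverse_inverse_eq by blast
  qed
  moreover have "\<exists>!N. is_mat_inverse n M N" using inverse unique by (rule ex1I)
  ultimately show ?thesis by simp
qed

end
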